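(* Let $f:[0,1]^D\to\mathbb{R}$ be bounded by a constant $M>0$ on $[0,1]^D$ (that is, $|f|\le M$), let $\xi\in[0,1]^D$, let $d$ be the number of superpixels used by LIME, and let $\nu>0$ be the bandwidth. Let $\epsilon>0$ and $\eta\in(0,1)$. Then there exists $\beta^f\in\mathbb{R}^{d+1}$ such that, for every $$n\ \ge\ \left\lceil \max\left(2^{15}d^4 e^{\frac{2}{\nu^2}},\ \frac{2^{21}d^7\max(M,M^2)\,e^{\frac{4}{\nu^2}}}{\epsilon^2}\right)\log\frac{8d}{\eta}\right\rceil ,$$ we have $\mathbb{P}\left(\|\hat\beta_n-\beta^f\|\ge\epsilon\right)\le\eta$, where $\hat\beta_n$ is the non-regularized LIME explanation computed from $n$ perturbed samples.
   Context: Setting (LIME for images). $\xi\in[0,1]^D$ is a fixed image with $D$ pixels. The superpixels $J_1,\dots,J_d$ are non-empty sets forming a partition of $\{1,\dots,D\}$. The replacement image $\bar\xi\in[0,1]^D$ is either constant equal to a given color, or the superpixel mean, $\bar\xi_u=\frac1{|J_k|}\sum_{v\in J_k}\xi_v$ for $u\in J_k$. Sampling. $z_1,\dots,z_n$ are i.i.d. random vectors uniformly distributed on $\{0,1\}^d$ (i.e. the coordinates $z_{i,j}$ are i.i.d. Bernoulli with parameter $1/2$). The perturbed image $x_i\in[0,1]^D$ is given by $x_{i,u}=z_{i,j}\xi_u+(1-z_{i,j})\bar\xi_u$ for $u\in J_j$, and $y_i=f(x_i)$. The weight of the $i$-th sample is $\pi_i=\psi(s_i/d)$, where $s_i=\#\{j: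 z_{i,j}=0\}$ and $\psi(t)=\exp\left(\frac{-(1-\sqrt{1-t})^2}{2\nu^2}\right)$ for $t\in[0,1]$. Explanation. Vectors of $\mathbb{R}^{d+1}$ are indexed by $0,\dots,d$, the coordinate $0$ being the intercept. $\hat\beta_n$ is a solution of the weighted least squares problem $$\hat\beta_n\in\operatorname*{arg\,min}_{\beta\in\mathbb{R}^{d+1}}\ \sum_{i=1}^n\pi_i\Bigl(y_i-\beta_0-\sum_{j=1}^d\beta_j z_{i,j}\Bigr)^2 .$$ $\|\cdot\|$ is the Euclidean norm. *)

theory Defs
  imports "HOL-Probability.Probability"
begin

text \<open>
  Pixels are the elements of the finite type \<^typ>\<open>'p\<close> (so \<open>D = CARD('p)\<close>) and the superpixels are
  indexed by the finite type \<^typ>\<open>'d\<close> (so \<open>d = CARD('d)\<close>). Vectors of \<open>\<real>\<^sup>d\<^sup>+\<^sup>1\<close> are indexed by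
  \<^typ>\<open>'d option\<close>: the coordinate \<^term>\<open>None\<close> is the intercept, and \<^term>\<open>Some j\<close> is the coefficient of
  superpixel \<open>j\<close>. A point of \<open>{0,1}\<^sup>d\<close> is a function \<^typ>\<open>'d \<Rightarrow> bool\<close>.
\<close>

definition images :: "(real ^ 'p::finite) set" where
  "images = {x. \<forall>u. x $ u \<in> {0..1}}"

definition superpixels :: "('d::finite \<Rightarrow> 'p::finite set) \<Rightarrow> bool" where
  "superpixels J \<longleftrightarrow> (\<forall>k. J k \<noteq> {}) \<and> disjoint_family J \<and> (\<Union>k. J k) = UNIV"

definition superpixel_of :: "('d::finite \<Rightarrow> 'p::finite set) \<Rightarrow> 'p \<Rightarrow> 'd" where
  "superpixel_of J u = (THE k. u \<in> J k)"

definition superpixel_mean :: "('d::finite \<Rightarrow> 'p::finite set) \<Rightarrow> real ^ 'p \<Rightarrow> real ^ 'p" where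
  "superpixel_mean J \<xi> =
     (\<chi> u. (\<Sum>v\<in>J (superpixel_of J u). \<xi> $ v) / real (card (J (superpixel_of J u))))"

definition replacement_image ::
    "('d::finite \<Rightarrow> 'p::finite set) \<Rightarrow> real ^ 'p \<Rightarrow> real ^ 'p \<Rightarrow> bool" where
  "replacement_image J \<xi> \<xi>bar \<longleftrightarrow>
     (\<exists>c\<in>{0..1}. \<xi>bar = (\<chi> u. c)) \<or> \<xi>bar = superpixel_mean J \<xi>"

definition perturbed_image ::
    "('d::finite \<Rightarrow> 'p::finite set) \<Rightarrow> real ^ 'p \<Rightarrow> real ^ 'p \<Rightarrow> ('d \<Rightarrow> bool) \<Rightarrow> real ^ 'p" where
  "perturbed_image J \<xi> \<xi>bar z =
     (\<chi> u. of_bool (z (superpixel_of J u)) * \<xi> $ u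
          + (1 - of_bool (z (superpixel_of J u))) * \<xi>bar $ u)"

definition lime_psi :: "real \<Rightarrow> real \<Rightarrow> real" where
  "lime_psi \<nu> t = exp (- ((1 - sqrt (1 - t))\<^sup>2) / (2 * \<nu>\<^sup>2))"

definition lime_weight :: "real \<Rightarrow> ('d::finite \<Rightarrow> bool) \<Rightarrow> real" where
  "lime_weight \<nu> z = lime_psi \<nu> (real (card {j. \<not> z j}) / real CARD('d))"

definition lime_loss ::
    "(real ^ 'p::finite \<Rightarrow> real) \<Rightarrow> ('d::finite \<Rightarrow> 'p set) \<Rightarrow> real ^ 'p \<Rightarrow> real ^ 'p \<Rightarrow> real
      \<Rightarrow> nat \<Rightarrow> (nat \<Rightarrow> 'd \<Rightarrow> bool) \<Rightarrow> real ^ ('d option) \<Rightarrow> real" where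
  "lime_loss f J \<xi> \<xi>bar \<nu> n z \<beta> =
     (\<Sum>i=1..n. lime_weight \<nu> (z i) *
        (f (perturbed_image J \<xi> \<xi>bar (z i)) - \<beta> $ None
          - (\<Sum>j\<in>UNIV. \<beta> $ Some j * of_bool (z i j)))\<^sup>2)"

text \<open>The minimizer need not be unique, hence a predicate rather than a function.\<close>

definition lime_explanation ::
    "(real ^ 'p::finite \<Rightarrow> real) \<Rightarrow> ('d::finite \<Rightarrow> 'p set) \<Rightarrow> real ^ 'p \<Rightarrow> real ^ 'p \<Rightarrow> real
      \<Rightarrow> nat \<Rightarrow> (nat \<Rightarrow> 'd \<Rightarrow> bool) \<Rightarrow> real ^ ('d option) \<Rightarrow> bool" where
  "lime_explanation f J \<xi> \<xi>bar \<nu> n z \<beta> \<longleftrightarrow>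
     is_arg_min (lime_loss f J \<xi> \<xi>bar \<nu> n z) (\<lambda>_. True) \<beta>"

definition lime_sampling ::
    "'w measure \<Rightarrow> nat \<Rightarrow> (nat \<Rightarrow> 'w \<Rightarrow> ('d::finite \<Rightarrow> bool)) \<Rightarrow> bool" where
  "lime_sampling P n z \<longleftrightarrow>
     prob_space P \<and>
     prob_space.indep_vars P (\<lambda>_. count_space UNIV) z {1..n} \<and>
     (\<forall>i\<in>{1..n}. distr P (count_space UNIV) (z i) = uniform_count_measure UNIV)"

end

theory Submission
  imports Defs
begin

text \<open>
  Take \<open>\<beta>\<close> to be the weighted least squares solution for the uniform distribution on \<open>{0,1}\<^sup>d\<close>. By the
  normal equations the error \<open>e\<close> of the sampled solution satisfies
  \<open>\<Sum>\<^sub>i \<pi>\<^sub>i (\<phi>\<^sub>i \<bullet> e)\<^sup>2 = e \<bullet> \<Sum>\<^sub>i \<zeta>\<^sub>i\<close>, where \<open>\<phi>\<^sub>i = (1, z\<^sub>i)\<close> and the vectors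
  \<open>\<zeta>\<^sub>i = \<pi>\<^sub>i (y\<^sub>i - \<phi>\<^sub>i \<bullet> \<beta>) \<phi>\<^sub>i\<close> are independent, centred and bounded. So \<open>e\<close> is small as soon as the
  coordinates of \<open>\<Sum>\<^sub>i \<zeta>\<^sub>i\<close> are small and the empirical Gram matrix is bounded below. For the latter
  the weights are simply bounded below by \<open>exp (- 1 / (2 \<nu>\<^sup>2))\<close>, and in the \<open>\<plusminus>1\<close> coordinates
  \<open>2 z\<^sub>j - 1\<close> the unweighted Gram matrix has diagonal entries exactly \<open>n\<close> and centred off-diagonal
  entries. Both events follow from Hoeffding's inequality, one scalar sum at a time.
\<close>

section \<open>Weighted least squares\<close>

text \<open>On the line through \<open>b\<close> in the direction of the displayed sum
  \<open>g\<close>, the loss is quadratic in the step \<open>s\<close> with linear coefficient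
  \<open>- 2 * (g \<bullet> g)\<close>, so minimality at \<open>b\<close> forces
  \<open>g = 0\<close>. This covers non-unique minimizers.\<close>

lemma least_squares_normal_equations:
  fixes \<phi> :: "'i \<Rightarrow> 'a::real_inner" and p y :: "'i \<Rightarrow> real"
  assumes min: "is_arg_min (\<lambda>\<beta>. \<Sum>i\<in>A. p i * (y i - \<phi> i \<bullet> \<beta>)\<^sup>2) (\<lambda>_. True) b"
    and p: "\<And>i. i \<in> A \<Longrightarrow> p i \<ge> 0"
  shows "(\<Sum>i\<in>A. (p i * (y i - \<phi> i \<bullet> b)) *\<^sub>R \<phi> i) = 0"
proof -
  define g where "g = (\<Sum>i\<in>A. (p i * (y i - \<phi> i \<bullet> b)) *\<^sub>R \<phi> i)"
  define H where "H = (\<Sum>i\<in>A. p i * (\<phi> i \<bullet> g)\<^sup>2)"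
  have gg: "(\<Sum>i\<in>A. p i * (y i - \<phi> i \<bullet> b) * (\<phi> i \<bullet> g)) = g \<bullet> g"
    by (subst (2) g_def) (simp add: inner_sum_left)
  have expand: "(\<Sum>i\<in>A. p i * (y i - \<phi> i \<bullet> (b + s *\<^sub>R g))\<^sup>2)
      = (\<Sum>i\<in>A. p i * (y i - \<phi> i \<bullet> b)\<^sup>2) - 2 * s * (g \<bullet> g) + s\<^sup>2 * H" for s
    unfolding gg[symmetric] H_def sum_distrib_left sum.distrib[symmetric] sum_subtractf[symmetric]
    by (intro sum.cong) (auto simp: inner_add_right power2_eq_square algebra_simps)
  have nonneg: "2 * s * (g \<bullet> g) \<le> s\<^sup>2 * H" for s
  proof -
    have "(\<Sum>i\<in>A. p i * (y i - \<phi> i \<bullet> b)\<^sup>2) \<le> (\<Sum>i\<in>A. p i * (y i - \<phi> i \<bullet> (b + s *\<^sub>R g))\<^sup>2)"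
      using min unfolding is_arg_min_linorder by blast
    then show ?thesis
      using expand[of s] by linarith
  qed
  have H: "H \<ge> 0"
    unfolding H_def by (intro sum_nonneg) (simp add: p)
  \<comment> \<open>A positive step with \<open>s * H < 2 * (g \<bullet> g)\<close> would lower the
    loss; the \<open>+ 1\<close> keeps the denominator positive when \<open>H = 0\<close>.\<close>
  define s where "s = g \<bullet> g / (H + 1)"
  have "g \<bullet> g = 0"
  proof (rule ccontr)
    assume "g \<bullet> g \<noteq> 0"
    then have gg_pos: "g \<bullet> g > 0"
      by (simp add: order_less_le)
    then have s: "s > 0"
      using H by (simp add: s_def)
    then have "2 * (g \<bullet> g) \<le> s * H"
      using nonneg[of s] by (simp add: power2_eq_square)
    also have "s * H \<le> s * (H + 1)"
      using s by simp
    also have "\<dots> = g \<bullet> g"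
      using H by (simp add: s_def)
    finally show False
      using gg_pos by simp
  qed
  then show ?thesis
    by (simp add: g_def)
qed

text \<open>Pairing the gradient sum at an arbitrary \<open>\<beta>\<close> with the error
  \<open>b - \<beta>\<close> gives the weighted quadratic form of the error. The Gram bound controls
  this form from below, Cauchy-Schwarz controls the pairing from above, and one factor
  \<open>norm (b - \<beta>)\<close> cancels.\<close>

lemma least_squares_error:
  fixes \<phi> :: "'i \<Rightarrow> 'a::real_inner" and p y :: "'i \<Rightarrow> real"
  assumes normal: "(\<Sum>i\<in>A. (p i * (y i - \<phi> i \<bullet> b)) *\<^sub>R \<phi> i) = 0"
    and w: "w \<ge> 0" "\<And>i. i \<in> A \<Longrightarrow> w \<le> p i"
    and gram: "\<And>v. \<kappa> * (norm v)\<^sup>2 \<le> (\<Sum>i\<in>A. (\<phi> i \<bullet> v)\<^sup>2)"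
  shows "w * \<kappa> * norm (b - \<beta>) \<le> norm (\<Sum>i\<in>A. (p i * (y i - \<phi> i \<bullet> \<beta>)) *\<^sub>R \<phi> i)"
proof -
  define e where "e = b - \<beta>"
  let ?g = "\<Sum>i\<in>A. (p i * (y i - \<phi> i \<bullet> \<beta>)) *\<^sub>R \<phi> i"
  have "w * \<kappa> * (norm e)\<^sup>2 \<le> w * (\<Sum>i\<in>A. (\<phi> i \<bullet> e)\<^sup>2)"
    using mult_left_mono[OF gram w(1)] by (simp add: mult.assoc)
  also have "\<dots> \<le> (\<Sum>i\<in>A. p i * (\<phi> i \<bullet> e)\<^sup>2)"
    unfolding sum_distrib_left by (intro sum_mono mult_right_mono w) auto
  \<comment> \<open>The subtracted sum vanishes by \<open>normal\<close>; in the difference of the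
    two residuals \<open>y i\<close> cancels and \<open>\<phi> i \<bullet> e\<close>
    remains.\<close>
  also have "\<dots> = ?g \<bullet> e - (\<Sum>i\<in>A. (p i * (y i - \<phi> i \<bullet> b)) *\<^sub>R \<phi> i) \<bullet> e"
    unfolding e_def inner_sum_left sum_subtractf[symmetric]
    by (intro sum.cong) (auto simp: inner_diff_right power2_eq_square algebra_simps)
  also have "\<dots> \<le> norm ?g * norm e"
    by (simp add: normal norm_cauchy_schwarz)
  finally have "(w * \<kappa> * norm e) * norm e \<le> norm ?g * norm e"
    by (simp add: power2_eq_square mult_ac)
  then show ?thesis
    unfolding e_def[symmetric] by (cases "e = 0") auto
qed

text \<open>The normal equations form a square linear system, so injectivity suffices; the Gram
  bound supplies it through the error estimate.\<close>

lemma least_squares_normal_equations_solvable: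
  fixes \<phi> :: "'i \<Rightarrow> 'a::euclidean_space" and p y :: "'i \<Rightarrow> real"
  assumes w: "w > 0" "\<And>i. i \<in> A \<Longrightarrow> w \<le> p i"
    and \<kappa>: "\<kappa> > 0"
    and gram: "\<And>v. \<kappa> * (norm v)\<^sup>2 \<le> (\<Sum>i\<in>A. (\<phi> i \<bullet> v)\<^sup>2)"
  obtains \<beta> where "(\<Sum>i\<in>A. (p i * (y i - \<phi> i \<bullet> \<beta>)) *\<^sub>R \<phi> i) = 0"
proof -
  define T where "T v = (\<Sum>i\<in>A. (p i * (\<phi> i \<bullet> v)) *\<^sub>R \<phi> i)" for v
  have lin: "linear T"
    unfolding T_def
    by (intro linearI) (auto simp: inner_add_right algebra_simps sum.distrib scaleR_sum_right)
  have "inj T"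
    unfolding linear_injective_0[OF lin]
  proof safe
    fix v assume "T v = 0"
    \<comment> \<open>The error estimate for zero responses, whose normal equations are solved by
      \<open>b = 0\<close>, compared with \<open>\<beta> = v\<close>.\<close>
    then have "w * \<kappa> * norm (0 - v) \<le> norm (\<Sum>i\<in>A. (p i * (0 - \<phi> i \<bullet> v)) *\<^sub>R \<phi> i)"
      using w gram by (intro least_squares_error) auto
    also have "\<dots> = norm (T v)"
      by (simp add: T_def sum_negf)
    finally show "v = 0"
      using \<open>T v = 0\<close> w(1) \<kappa> by (simp add: mult_le_0_iff)
  qed
  with lin have "surj T"
    by (rule linear_inj_imp_surj)
  then obtain \<beta> where "T \<beta> = (\<Sum>i\<in>A. (p i * y i) *\<^sub>R \<phi> i)"
    by (metis surjD)
  then have "(\<Sum>i\<in>A. (p i * (y i - \<phi> i \<bullet> \<beta>)) *\<^sub>R \<phi> i) = 0"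
    by (simp add: T_def algebra_simps sum_subtractf)
  then show thesis ..
qed

section \<open>Design vectors in sign coordinates\<close>

definition design :: "('d::finite \<Rightarrow> bool) \<Rightarrow> real ^ ('d option)" where
  "design z = (\<chi> k. case k of None \<Rightarrow> 1 | Some j \<Rightarrow> of_bool (z j))"

text \<open>These are the Walsh characters of degree at most one, which are orthonormal under the
  uniform distribution.\<close>

definition signs :: "('d \<Rightarrow> bool) \<Rightarrow> 'd option \<Rightarrow> real" where
  "signs z k = (case k of None \<Rightarrow> 1 | Some j \<Rightarrow> if z j then 1 else -1)"

text \<open>The change of coefficients induced by writing each 0/1 coordinate as half of one plus
  its sign: slopes are halved and the intercept absorbs the other halves.\<close>

definition sign_coeff :: "real ^ ('d::finite option) \<Rightarrow> 'd option \<Rightarrow> real" where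
  "sign_coeff v k =
     (case k of None \<Rightarrow> v $ None + (\<Sum>j\<in>UNIV. v $ Some j) / 2 | Some j \<Rightarrow> v $ Some j / 2)"

lemma sum_UNIV_option:
  fixes g :: "'d::finite option \<Rightarrow> real"
  shows "(\<Sum>k\<in>UNIV. g k) = g None + (\<Sum>j\<in>UNIV. g (Some j))"
  by (simp add: UNIV_option_conv sum.reindex)

lemma card_UNIV_option: "CARD('d::finite option) = Suc CARD('d)"
  by (simp add: UNIV_option_conv card_image)

lemma design_inner: "design z \<bullet> \<beta> = \<beta> $ None + (\<Sum>j\<in>UNIV. \<beta> $ Some j * of_bool (z j))"
  by (simp add: inner_vec_def sum_UNIV_option design_def mult.commute)

lemma design_inner_signs: "design z \<bullet> v = (\<Sum>k\<in>UNIV. sign_coeff v k * signs z k)"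
proof -
  have "of_bool (z j) * v $ Some j = v $ Some j / 2 + v $ Some j / 2 * signs z (Some j)" for j
    by (simp add: signs_def)
  then show ?thesis
    by (simp add: design_inner sum_UNIV_option sign_coeff_def signs_def sum.distrib
        sum_divide_distrib mult.commute)
qed

lemma design_component: "design z $ k \<in> {0..1}"
  by (simp add: design_def split: option.split)

lemma norm_design_le: "norm (design (z :: 'd::finite \<Rightarrow> bool)) \<le> sqrt (real CARD('d) + 1)"
proof -
  have "(norm (design z))\<^sup>2 = (\<Sum>k\<in>UNIV. (design z $ k)\<^sup>2)"
    unfolding power2_norm_eq_inner by (simp add: inner_vec_def power2_eq_square)
  also have "\<dots> \<le> (\<Sum>k\<in>(UNIV :: 'd option set). 1)"
    using design_component[of z] by (intro sum_mono) (simp add: power_le_one)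
  finally show ?thesis
    by (simp add: card_UNIV_option real_le_rsqrt add.commute)
qed

text \<open>Inverting the change of coordinates subtracts half the sum of the slopes from the
  intercept; Cauchy-Schwarz on that sum costs the factor \<open>d\<close>. The 6 is
  \<open>4 * (3 / 2)\<close>: the 4 undoes the halving of slopes, and
  \<open>d / 2 + 1 \<le> 3 / 2 * d\<close>.\<close>

lemma norm_le_sign_coeff:
  fixes v :: "real ^ ('d::finite option)"
  shows "(norm v)\<^sup>2 \<le> 6 * real CARD('d) * (\<Sum>k\<in>UNIV. (sign_coeff v k)\<^sup>2)"
proof -
  define d where "d = real CARD('d)"
  have d: "d \<ge> 1"
    by (simp add: d_def Suc_le_eq)
  define a S V where "a = sign_coeff v None" and "S = (\<Sum>j\<in>UNIV. v $ Some j)"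
    and "V = (\<Sum>j\<in>UNIV. (v $ Some j)\<^sup>2)"
  have V: "V \<ge> 0" by (simp add: V_def sum_nonneg)
  have "S\<^sup>2 \<le> d * V"
    unfolding S_def V_def d_def
    using sum_squared_le_sum_of_squares[of "\<lambda>j. v $ Some j" UNIV] by (simp add: mult.commute)
  moreover have "(v $ None)\<^sup>2 \<le> 2 * a\<^sup>2 + S\<^sup>2 / 2"
  proof -
    have v: "v $ None = a - S / 2" by (simp add: a_def S_def sign_coeff_def)
    have "0 \<le> (a + S / 2)\<^sup>2" by simp
    then show ?thesis unfolding v by (simp add: power2_eq_square field_simps)
  qed
  ultimately have "(v $ None)\<^sup>2 + V \<le> 2 * a\<^sup>2 + (d / 2 + 1) * V"
    by (simp add: algebra_simps)
  also have "\<dots> \<le> 6 * d * a\<^sup>2 + 3 / 2 * d * V"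
    using d V by (intro add_mono mult_right_mono) auto
  also have "\<dots> = 6 * d * (\<Sum>k\<in>UNIV. (sign_coeff v k)\<^sup>2)"
    by (simp add: sum_UNIV_option a_def V_def sign_coeff_def power_divide sum_divide_distrib[symmetric]
        algebra_simps)
  finally show ?thesis
    unfolding power2_norm_eq_inner
    by (simp add: inner_vec_def power2_eq_square sum_UNIV_option V_def d_def)
qed

text \<open>Diagonal dominance: the diagonal of the Gram matrix is exactly \<open>card A\<close>,
  and the off-diagonal part costs at most \<open>t\<close> times the squared l1 norm of
  \<open>c\<close>, which Cauchy-Schwarz compares with the squared l2 norm.\<close>

lemma near_orthogonal_gram_ge:
  fixes \<sigma> :: "'i \<Rightarrow> 'k::finite \<Rightarrow> real"
  assumes unit: "\<And>i k. i \<in> A \<Longrightarrow> (\<sigma> i k)\<^sup>2 = 1"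
    and off: "\<And>k l. k \<noteq> l \<Longrightarrow> \<bar>\<Sum>i\<in>A. \<sigma> i k * \<sigma> i l\<bar> \<le> t"
    and t: "t \<ge> 0"
  shows "(real (card A) - t * real CARD('k)) * (\<Sum>k\<in>UNIV. (c k)\<^sup>2)
           \<le> (\<Sum>i\<in>A. (\<Sum>k\<in>UNIV. c k * \<sigma> i k)\<^sup>2)"
proof -
  define m where "m k l = (\<Sum>i\<in>A. \<sigma> i k * \<sigma> i l)" for k l
  have m_diag: "m k k = real (card A)" for k
    using unit by (simp add: m_def power2_eq_square[symmetric])
  \<comment> \<open>The deduction is made on the diagonal as well, so that its double sum factors
    into the square of a single sum.\<close>
  have entry: "(if k = l then real (card A) * (c k)\<^sup>2 else 0) - t * (\<bar>c k\<bar> * \<bar>c l\<bar>)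
      \<le> c k * c l * m k l" for k l
  proof (cases "k = l")
    case True
    then show ?thesis
      using t by (simp add: m_diag power2_eq_square mult_ac)
  next
    case False
    have "\<bar>c k * c l * m k l\<bar> \<le> \<bar>c k * c l\<bar> * t"
      unfolding abs_mult[of "c k * c l"] m_def using off[OF False] by (intro mult_left_mono) auto
    also have "\<bar>c k * c l\<bar> * t = t * (\<bar>c k\<bar> * \<bar>c l\<bar>)"
      by (simp add: abs_mult mult_ac)
    finally show ?thesis
      using False by (simp add: abs_le_iff)
  qed
  have "(\<Sum>k\<in>UNIV. \<bar>c k\<bar>)\<^sup>2 \<le> (\<Sum>k\<in>UNIV. (c k)\<^sup>2) * real CARD('k)"
    using sum_squared_le_sum_of_squares[of "\<lambda>k. \<bar>c k\<bar>" UNIV] by simp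
  then have "t * (\<Sum>k\<in>UNIV. \<bar>c k\<bar>)\<^sup>2 \<le> t * ((\<Sum>k\<in>UNIV. (c k)\<^sup>2) * real CARD('k))"
    using t by (rule mult_left_mono)
  then have "(real (card A) - t * real CARD('k)) * (\<Sum>k\<in>UNIV. (c k)\<^sup>2)
      \<le> real (card A) * (\<Sum>k\<in>UNIV. (c k)\<^sup>2) - t * (\<Sum>k\<in>UNIV. \<bar>c k\<bar>)\<^sup>2"
    by (simp add: algebra_simps)
  also have "\<dots> = (\<Sum>k\<in>UNIV. \<Sum>l\<in>UNIV.
      (if k = l then real (card A) * (c k)\<^sup>2 else 0) - t * (\<bar>c k\<bar> * \<bar>c l\<bar>))"
  proof -
    have "t * (\<Sum>k\<in>UNIV. \<bar>c k\<bar>)\<^sup>2 = (\<Sum>k\<in>UNIV. \<Sum>l\<in>UNIV. t * (\<bar>c k\<bar> * \<bar>c l\<bar>))"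
      by (simp only: power2_eq_square sum_product, simp only: sum_distrib_left)
    then show ?thesis
      by (simp add: sum_subtractf sum_distrib_left)
  qed
  also have "\<dots> \<le> (\<Sum>k\<in>UNIV. \<Sum>l\<in>UNIV. c k * c l * m k l)"
    by (intro sum_mono entry)
  also have "\<dots> = (\<Sum>k\<in>UNIV. \<Sum>l\<in>UNIV. \<Sum>i\<in>A. (c k * \<sigma> i k) * (c l * \<sigma> i l))"
    by (simp add: m_def sum_distrib_left mult_ac)
  also have "\<dots> = (\<Sum>k\<in>UNIV. \<Sum>i\<in>A. \<Sum>l\<in>UNIV. (c k * \<sigma> i k) * (c l * \<sigma> i l))"
    by (intro sum.cong refl sum.swap)
  also have "\<dots> = (\<Sum>i\<in>A. \<Sum>k\<in>UNIV. \<Sum>l\<in>UNIV. (c k * \<sigma> i k) * (c l * \<sigma> i l))"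
    by (rule sum.swap)
  finally show ?thesis
    by (simp add: power2_eq_square sum_product)
qed

text \<open>With \<open>d + 1\<close> sign coordinates, the tolerance \<open>1 / (4 * d)\<close>
  loses a fraction \<open>(d + 1) / (4 * d) \<le> 1 / 2\<close> of the diagonal; dividing the
  remaining half by the \<open>6 * d\<close> of the coordinate change gives \<open>12 * d\<close>.
  It serves both the full cube and the sample.\<close>

lemma design_gram_ge:
  fixes z :: "'i \<Rightarrow> 'd::finite \<Rightarrow> bool"
  assumes off: "\<And>k l. k \<noteq> l \<Longrightarrow> \<bar>\<Sum>i\<in>A. signs (z i) k * signs (z i) l\<bar> \<le> real (card A) / (4 * real CARD('d))"
  shows "real (card A) / (12 * real CARD('d)) * (norm v)\<^sup>2 \<le> (\<Sum>i\<in>A. (design (z i) \<bullet> v)\<^sup>2)"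
proof -
  define d where "d = real CARD('d)"
  have d: "d \<ge> 1"
    by (simp add: d_def Suc_le_eq)
  define Q where "Q = (\<Sum>k\<in>UNIV. (sign_coeff v k)\<^sup>2)"
  have Q: "Q \<ge> 0" by (simp add: Q_def sum_nonneg)
  have "real (card A) / (12 * d) * (norm v)\<^sup>2 \<le> real (card A) / (12 * d) * (6 * d * Q)"
    using norm_le_sign_coeff[of v] d unfolding d_def Q_def by (intro mult_left_mono) auto
  also have "\<dots> = real (card A) * (1 / 2) * Q"
    using d by simp
  also have "\<dots> \<le> real (card A) * (1 - (d + 1) / (4 * d)) * Q"
    using d Q by (intro mult_right_mono mult_left_mono) (auto simp: field_simps)
  also have "\<dots> = (real (card A) - real (card A) / (4 * d) * real CARD('d option)) * Q"
    by (simp add: card_UNIV_option d_def algebra_simps)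
  also have "\<dots> \<le> (\<Sum>i\<in>A. (design (z i) \<bullet> v)\<^sup>2)"
    unfolding Q_def design_inner_signs
    by (rule near_orthogonal_gram_ge) (use off d in \<open>auto simp: d_def signs_def split: option.split\<close>)
  finally show ?thesis by (simp add: d_def)
qed

text \<open>Distinct indices cannot both be \<open>None\<close>. Flipping the coordinate of one that
  is \<open>Some j\<close> permutes the cube and negates the product.\<close>

lemma sum_signs_mult_eq_0:
  fixes k l :: "'d::finite option"
  assumes "k \<noteq> l"
  shows "(\<Sum>z\<in>UNIV. signs z k * signs z l) = 0"
proof -
  have *: "(\<Sum>z\<in>UNIV. signs z (Some j) * signs z m) = 0" if "m \<noteq> Some j" for j :: 'd and m
  proof -
    define flip where "flip z = z(j := \<not> z j)" for z :: "'d \<Rightarrow> bool"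
    have "bij flip"
      by (intro o_bij[of flip]) (auto simp: flip_def fun_eq_iff)
    then have "(\<Sum>z\<in>UNIV. signs z (Some j) * signs z m)
        = (\<Sum>z\<in>UNIV. signs (flip z) (Some j) * signs (flip z) m)"
      by (intro sum.reindex_bij_betw[symmetric])
    also have "\<dots> = (\<Sum>z\<in>UNIV. - (signs z (Some j) * signs z m))"
      using that by (intro sum.cong) (auto simp: signs_def flip_def split: option.split)
    finally show ?thesis
      by (simp add: sum_negf)
  qed
  show ?thesis
  proof (cases k)
    case None
    then obtain j where "l = Some j" using assms by (cases l) auto
    then show ?thesis using *[of k j] assms by (simp add: mult.commute)
  next
    case (Some j)
    then show ?thesis using *[of l j] assms by simp
  qed
qed

section \<open>The LIME model\<close>

text \<open>The lower bound is the value of \<open>lime_psi\<close> at 1, the case where every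
  superpixel is replaced.\<close>

lemma lime_weight_bounds:
  assumes "\<nu> > 0"
  shows "lime_weight \<nu> z \<le> 1" "exp (- 1 / (2 * \<nu>\<^sup>2)) \<le> lime_weight \<nu> z"
proof -
  define t where "t = real (card {j. \<not> z j}) / real CARD('a)"
  have "card {j. \<not> z j} \<le> CARD('a)"
    by (intro card_mono) auto
  then have "0 \<le> t" "t \<le> 1"
    by (auto simp: t_def)
  then have "(1 - sqrt (1 - t))\<^sup>2 \<le> 1"
    by (intro power_le_one) auto
  then show "lime_weight \<nu> z \<le> 1" "exp (- 1 / (2 * \<nu>\<^sup>2)) \<le> lime_weight \<nu> z"
    using assms by (auto simp: lime_weight_def lime_psi_def t_def[symmetric] divide_right_mono)
qed

lemma replacement_image_in_images:
  assumes "replacement_image J \<xi> \<xi>bar" "\<xi> \<in> images"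
  shows "\<xi>bar \<in> images"
proof -
  have "superpixel_mean J \<xi> $ u \<in> {0..1}" for u
  proof -
    let ?K = "J (superpixel_of J u)"
    have "(\<Sum>v\<in>?K. \<xi> $ v) \<le> (\<Sum>v\<in>?K. 1)" "(\<Sum>v\<in>?K. \<xi> $ v) \<ge> 0"
      using assms(2) by (auto simp: images_def intro!: sum_mono sum_nonneg simp del: sum_constant)
    then show ?thesis
      by (auto simp: superpixel_mean_def divide_le_eq_1)
  qed
  then show ?thesis
    using assms(1) by (auto simp: replacement_image_def images_def)
qed

lemma perturbed_image_in_images:
  assumes "\<xi> \<in> images" "\<xi>bar \<in> images"
  shows "perturbed_image J \<xi> \<xi>bar z \<in> images"
  using assms by (auto simp: perturbed_image_def images_def of_bool_def)

lemma lime_explanation_iff_least_squares: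
  "lime_explanation f J \<xi> \<xi>bar \<nu> n z b \<longleftrightarrow>
     is_arg_min (\<lambda>\<beta>. \<Sum>i=1..n. lime_weight \<nu> (z i) *
       (f (perturbed_image J \<xi> \<xi>bar (z i)) - design (z i) \<bullet> \<beta>)\<^sup>2) (\<lambda>_. True) b"
  unfolding lime_explanation_def lime_loss_def design_inner diff_diff_eq ..

text \<open>Two-sided Hoeffding for variables in an interval of length \<open>2 * B\<close>. Under
  uniform sampling, a zero sum over the cube means zero expectation. Measurability is stated
  separately for the later union bound.\<close>

lemma lime_sampling_deviation:
  fixes g :: "('d::finite \<Rightarrow> bool) \<Rightarrow> real"
  assumes samp: "lime_sampling P n z"
    and n: "n > 0"
    and B: "B > 0" "\<And>a. \<bar>g a\<bar> \<le> B"
    and mean: "(\<Sum>a\<in>UNIV. g a) = 0"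
    and t: "t \<ge> 0"
  shows "{\<omega> \<in> space P. \<bar>\<Sum>i=1..n. g (z i \<omega>)\<bar> \<ge> real n * t} \<in> sets P" (is "?S \<in> _")
    and "measure P {\<omega> \<in> space P. \<bar>\<Sum>i=1..n. g (z i \<omega>)\<bar> \<ge> real n * t}
           \<le> 2 * exp (- (real n * t\<^sup>2 / (2 * B\<^sup>2)))"
proof -
  interpret prob_space P
    using samp by (simp add: lime_sampling_def)
  have indep: "indep_vars (\<lambda>_. count_space UNIV) z {1..n}"
    and distr: "\<And>i. i \<in> {1..n} \<Longrightarrow> distr P (count_space UNIV) (z i) = uniform_count_measure UNIV"
    using samp by (auto simp: lime_sampling_def)
  have indep': "indep_vars (\<lambda>_. borel) (\<lambda>i \<omega>. g (z i \<omega>)) {1..n}"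
    by (rule indep_vars_compose2[OF indep]) simp
  have meas [measurable]: "z i \<in> measurable P (count_space UNIV)" if "i \<in> {1..n}" for i
    using indep that by (auto simp: indep_vars_def)
  show "?S \<in> sets P"
    using indep' unfolding indep_vars_def by measurable
  have "expectation (\<lambda>\<omega>. g (z i \<omega>)) = 0" if "i \<in> {1..n}" for i
  proof -
    have "expectation (\<lambda>\<omega>. g (z i \<omega>)) = integral\<^sup>L (distr P (count_space UNIV) (z i)) g"
      using meas[OF that] by (intro integral_distr[symmetric]) auto
    also have "\<dots> = 0"
      unfolding distr[OF that] by (subst integral_uniform_count_measure) (auto simp: mean)
    finally show ?thesis .
  qed
  then have mu: "0 = (\<Sum>i\<in>{1..n}. expectation (\<lambda>\<omega>. g (z i \<omega>)))"
    by simp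
  have "g a \<in> {- B..B}" for a
    using B(2)[of a] by auto
  then interpret Hoeffding_ineq P "{1..n}" "\<lambda>i \<omega>. g (z i \<omega>)" "\<lambda>_. - B" "\<lambda>_. B" 0
    by unfold_locales (use indep' mu in auto)
  have "prob ?S \<le> 2 * exp (- 2 * (real n * t)\<^sup>2 / (\<Sum>i\<in>{1..n}. (B - - B)\<^sup>2))"
    using Hoeffding_ineq_abs_ge[of "real n * t"] t n B(1) by simp
  also have "- 2 * (real n * t)\<^sup>2 / (\<Sum>i\<in>{1..n}. (B - - B)\<^sup>2) = - (real n * t\<^sup>2 / (2 * B\<^sup>2))"
    using n B(1) by (simp add: power2_eq_square field_simps)
  finally show "prob ?S \<le> 2 * exp (- (real n * t\<^sup>2 / (2 * B\<^sup>2)))" .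
qed


section \<open>Accuracy of the sampled explanation\<close>

lemma norm_less_sqrt_card:
  fixes x :: "real ^ 'k::finite"
  assumes "\<And>k. \<bar>x $ k\<bar> < c"
  shows "norm x < sqrt (real CARD('k)) * c"
proof -
  \<comment> \<open>The index type is inhabited, so one instance of the strict bound is
    available.\<close>
  have "c > 0"
    using assms[of undefined] by linarith
  have "(norm x)\<^sup>2 = (\<Sum>k\<in>UNIV. (x $ k)\<^sup>2)"
    unfolding power2_norm_eq_inner by (simp add: inner_vec_def power2_eq_square)
  also have "\<dots> < (\<Sum>k\<in>(UNIV :: 'k set). c\<^sup>2)"
    using assms \<open>c > 0\<close> by (intro sum_strict_mono) (auto simp: abs_square_less_1 intro!: power2_strict_mono)
  also have "\<dots> = (sqrt (real CARD('k)) * c)\<^sup>2"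
    by (simp add: power_mult_distrib)
  finally show ?thesis
    by (rule power2_less_imp_less) (use \<open>c > 0\<close> in simp)
qed

text \<open>On the full cube the sign characters are exactly orthogonal, so the Gram bound holds and
  the normal equations are solvable. The second conclusion is the range needed for Hoeffding: the
  fitted value contributes 24 and the response 1 to the constant 25.\<close>

lemma population_solution:
  fixes p y :: "('d::finite \<Rightarrow> bool) \<Rightarrow> real"
  assumes w: "0 < w" "\<And>a. w \<le> p a" "\<And>a. p a \<le> 1"
    and M: "M > 0" "\<And>a. \<bar>y a\<bar> \<le> M"
  obtains \<beta> :: "real ^ ('d option)" where
    "(\<Sum>a\<in>UNIV. (p a * (y a - design a \<bullet> \<beta>)) *\<^sub>R design a) = 0"
    "\<And>a k. \<bar>p a * (y a - design a \<bullet> \<beta>) * design a $ k\<bar> \<le> 25 * real CARD('d) ^ 2 * M / w"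
proof -
  define d N where "d = real CARD('d)" and "N = real CARD('d \<Rightarrow> bool)"
  have d: "d \<ge> 1"
    by (simp add: d_def Suc_le_eq)
  have N: "N > 0"
    unfolding N_def by (simp add: card_gt_0_iff)
  have gram: "N / (12 * d) * (norm v)\<^sup>2 \<le> (\<Sum>a\<in>UNIV. (design a \<bullet> v)\<^sup>2)" for v :: "real ^ ('d option)"
    unfolding N_def d_def
    by (rule design_gram_ge[where z = "\<lambda>a. a"]) (simp add: sum_signs_mult_eq_0)
  obtain \<beta> :: "real ^ ('d option)"
    where \<beta>: "(\<Sum>a\<in>UNIV. (p a * (y a - design a \<bullet> \<beta>)) *\<^sub>R design a) = 0"
    by (rule least_squares_normal_equations_solvable[where \<phi> = design and p = p and y = y and w = w and \<kappa> = "N / (12 * d)"])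
       (use w N d gram in \<open>simp_all\<close>)
  have w1: "w \<le> 1"
    using w(2,3) order_trans by blast
  \<comment> \<open>Comparing with the zero vector bounds \<open>\<beta>\<close> itself, since the
    residuals at zero are just the responses.\<close>
  have "w * (N / (12 * d)) * norm (\<beta> - 0) \<le> norm (\<Sum>a\<in>UNIV. (p a * (y a - design a \<bullet> 0)) *\<^sub>R design a)"
    using \<beta> w gram by (intro least_squares_error) auto
  also have "\<dots> \<le> (\<Sum>a\<in>(UNIV :: ('d \<Rightarrow> bool) set). M * sqrt (d + 1))"
  proof (rule sum_norm_le)
    fix a :: "'d \<Rightarrow> bool"
    have "\<bar>p a\<bar> * \<bar>y a\<bar> \<le> 1 * M"
      using w(1) w(2,3)[of a] M(2)[of a] by (intro mult_mono) auto
    then show "norm ((p a * (y a - design a \<bullet> 0)) *\<^sub>R design a) \<le> M * sqrt (d + 1)"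
      using norm_design_le[of a] M(1) by (auto simp: d_def abs_mult intro!: mult_mono)
  qed
  also have "\<dots> = N * (M * sqrt (d + 1))"
    by (simp add: N_def)
  finally have norm_\<beta>: "norm \<beta> \<le> 12 * d * M * sqrt (d + 1) / w"
    using N d w(1) by (simp add: field_simps)
  have "\<bar>p a * (y a - design a \<bullet> \<beta>) * design a $ k\<bar> \<le> 25 * d ^ 2 * M / w" for a k
  proof -
    have "\<bar>design a \<bullet> \<beta>\<bar> \<le> norm (design a) * norm \<beta>"
      by (rule Cauchy_Schwarz_ineq2)
    also have "\<dots> \<le> sqrt (d + 1) * (12 * d * M * sqrt (d + 1) / w)"
      using norm_design_le[of a] norm_\<beta> d by (intro mult_mono) (auto simp: d_def)
    also have "\<dots> = 12 * d * (sqrt (d + 1) * sqrt (d + 1)) * M / w"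
      by (simp only: times_divide_eq_right mult_ac)
    also have "\<dots> = 12 * d * (d + 1) * M / w"
      using d by simp
    also have "\<dots> \<le> 12 * d * (2 * d) * M / w"
      using d M(1) w(1) by (intro divide_right_mono mult_right_mono mult_left_mono) auto
    finally have fit: "\<bar>design a \<bullet> \<beta>\<bar> \<le> 24 * d ^ 2 * M / w"
      by (simp add: power2_eq_square)
    \<comment> \<open>As \<open>w \<le> 1 \<le> d ^ 2\<close>, the bare bound \<open>M\<close> on
      the response fits under \<open>d ^ 2 * M / w\<close>.\<close>
    have "w * 1 \<le> 1 * d ^ 2"
      using w1 d w(1) by (intro mult_mono) auto
    then have "M * w \<le> M * d ^ 2"
      using M(1) by simp
    then have "M \<le> d ^ 2 * M / w"
      using w(1) by (simp add: field_simps)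
    moreover have "25 * d ^ 2 * M / w = d ^ 2 * M / w + 24 * d ^ 2 * M / w"
      by (simp add: add_divide_distrib[symmetric])
    ultimately have "\<bar>y a - design a \<bullet> \<beta>\<bar> \<le> 25 * d ^ 2 * M / w"
      using fit M(2)[of a] by linarith
    then have "\<bar>p a\<bar> * \<bar>y a - design a \<bullet> \<beta>\<bar> * \<bar>design a $ k\<bar> \<le> 1 * (25 * d ^ 2 * M / w) * 1"
      using w(1) w(2,3)[of a] design_component[of a k] by (intro mult_mono) auto
    then show ?thesis
      by (simp add: abs_mult)
  qed
  then show thesis
    using that \<beta> by (simp add: d_def)
qed

text \<open>The deterministic half of the argument, on the good event. The gradient tolerance is
  chosen so that \<open>sqrt (d + 1)\<close>, lost in passing from coordinates to the norm, cancels
  and exactly \<open>\<epsilon>\<close> times the curvature \<open>w * n / (12 * d)\<close> is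
  left.\<close>

lemma sample_solution_error:
  fixes z :: "nat \<Rightarrow> 'd::finite \<Rightarrow> bool" and p y :: "('d \<Rightarrow> bool) \<Rightarrow> real"
  assumes w: "0 < w" "\<And>a. w \<le> p a" and n: "n > 0"
    and min: "is_arg_min (\<lambda>\<beta>. \<Sum>i=1..n. p (z i) * (y (z i) - design (z i) \<bullet> \<beta>)\<^sup>2) (\<lambda>_. True) b"
    and off: "\<And>k l. k \<noteq> l \<Longrightarrow>
      \<bar>\<Sum>i=1..n. signs (z i) k * signs (z i) l\<bar> \<le> real n * (1 / (4 * real CARD('d)))"
    and grad: "\<And>k. \<bar>\<Sum>i=1..n. p (z i) * (y (z i) - design (z i) \<bullet> \<beta>) * design (z i) $ k\<bar>
      < real n * (\<epsilon> * w / (12 * real CARD('d) * sqrt (real CARD('d) + 1)))"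
  shows "norm (b - \<beta>) < \<epsilon>"
proof -
  define d where "d = real CARD('d)"
  have d: "d \<ge> 1"
    by (simp add: d_def Suc_le_eq)
  have gram: "real n / (12 * d) * (norm v)\<^sup>2 \<le> (\<Sum>i=1..n. (design (z i) \<bullet> v)\<^sup>2)" for v
    using design_gram_ge[where A = "{1..n}" and z = z and v = v] off by (simp add: d_def)
  have "p a \<ge> 0" for a
    using w(1) w(2)[of a] by linarith
  then have "(\<Sum>i=1..n. (p (z i) * (y (z i) - design (z i) \<bullet> b)) *\<^sub>R design (z i)) = 0"
    by (intro least_squares_normal_equations[OF min])
  then have "w * (real n / (12 * d)) * norm (b - \<beta>)
      \<le> norm (\<Sum>i=1..n. (p (z i) * (y (z i) - design (z i) \<bullet> \<beta>)) *\<^sub>R design (z i))"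
    using w gram by (intro least_squares_error) auto
  also have "\<dots> < sqrt (real CARD('d option)) * (real n * (\<epsilon> * w / (12 * d * sqrt (d + 1))))"
    by (rule norm_less_sqrt_card) (use grad in \<open>simp add: d_def\<close>)
  also have "\<dots> = w * (real n / (12 * d)) * \<epsilon>"
    using d by (simp add: card_UNIV_option d_def[symmetric] add.commute)
  finally show ?thesis
    by (rule mult_left_less_imp_less) (use w(1) d in simp)
qed

text \<open>The right-hand sides are the Hoeffding exponents for sign products and for gradient
  coordinates. The former must reach \<open>2 * L\<close> because the number of index pairs is
  quadratic in \<open>d\<close>.\<close>

lemma sample_size_exponents:
  fixes d w M \<epsilon> L n :: real
  assumes d: "d \<ge> 1" and w: "0 < w" "w \<le> 1" and M: "M > 0" and \<epsilon>: "\<epsilon> > 0" and L: "L \<ge> 0"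
    and n: "n \<ge> max (2 ^ 15 * d ^ 4 / w ^ 4) (2 ^ 21 * d ^ 7 * max M (M\<^sup>2) / w ^ 8 / \<epsilon>\<^sup>2) * L"
  shows "2 * L \<le> n * (1 / (4 * d))\<^sup>2 / (2 * 1\<^sup>2)"
    and "L \<le> n * (\<epsilon> * w / (12 * d * sqrt (d + 1)))\<^sup>2 / (2 * (25 * d ^ 2 * M / w)\<^sup>2)"
proof -
  have n1: "n \<ge> 2 ^ 15 * d ^ 4 / w ^ 4 * L"
    and n2: "n \<ge> 2 ^ 21 * d ^ 7 * max M (M\<^sup>2) / w ^ 8 / \<epsilon>\<^sup>2 * L"
    using n L by (meson max.cobounded1 max.cobounded2 mult_right_mono order_trans)+
  have "64 * d ^ 2 * L \<le> 2 ^ 15 * d ^ 4 * L"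
    using d L by (intro mult_right_mono mult_mono power_increasing) auto
  also have "\<dots> \<le> 2 ^ 15 * d ^ 4 / w ^ 4 * L"
    using w d L by (intro mult_right_mono) (auto simp: le_divide_eq mult_left_le power_le_one)
  finally have "64 * d ^ 2 * L \<le> n"
    using n1 by linarith
  then show "2 * L \<le> n * (1 / (4 * d))\<^sup>2 / (2 * 1\<^sup>2)"
    using d by (simp add: power2_eq_square field_simps)
  \<comment> \<open>The squared constants 12 and 25 of the statement and Hoeffding's factor 2 multiply to 180000.\<close>
  have "2 * 625 * 144 * (d ^ 6 * (d + 1)) \<le> 2 * 625 * 144 * (d ^ 6 * (2 * d))"
    using d by (intro mult_left_mono) auto
  also have "\<dots> \<le> 2 ^ 21 * d ^ 7"
    using d by (simp add: power_numeral_reduce)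
  finally have D: "180000 * (d ^ 6 * (d + 1)) \<le> 2 ^ 21 * d ^ 7"
    by simp
  \<comment> \<open>Besides \<open>D\<close>, this uses that the square of \<open>M\<close> is below
    the maximum and that \<open>w ^ 8 \<le> w ^ 4\<close>.\<close>
  have "180000 * (d ^ 6 * (d + 1)) * M\<^sup>2 / w ^ 4 / \<epsilon>\<^sup>2 * L
      \<le> 2 ^ 21 * d ^ 7 * max M (M\<^sup>2) / w ^ 8 / \<epsilon>\<^sup>2 * L"
    using d w M L
    by (intro mult_right_mono divide_right_mono frac_le mult_mono D power_decreasing) auto
  then have "180000 * (d ^ 6 * (d + 1)) * M\<^sup>2 / w ^ 4 / \<epsilon>\<^sup>2 * L \<le> n"
    using n2 by linarith
  moreover have "180000 * (d ^ 6 * (d + 1)) * M\<^sup>2 / w ^ 4 / \<epsilon>\<^sup>2 > 0"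
    using d w M \<epsilon> by simp
  ultimately have "L \<le> n / (180000 * (d ^ 6 * (d + 1)) * M\<^sup>2 / w ^ 4 / \<epsilon>\<^sup>2)"
    by (simp only: pos_le_divide_eq mult.commute[of L])
  also have "\<dots> = n * (\<epsilon>\<^sup>2 * w\<^sup>2 / (144 * d\<^sup>2 * (d + 1))) / (2 * (625 * d ^ 4 * M\<^sup>2 / w\<^sup>2))"
    by (simp add: power_numeral_reduce mult_ac)
  also have "\<dots> = n * (\<epsilon> * w / (12 * d * sqrt (d + 1)))\<^sup>2 / (2 * (25 * d ^ 2 * M / w)\<^sup>2)"
    using d by (simp add: power_divide power_mult_distrib)
  finally show "L \<le> n * (\<epsilon> * w / (12 * d * sqrt (d + 1)))\<^sup>2 / (2 * (25 * d ^ 2 * M / w)\<^sup>2)" .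
qed

text \<open>The witness is the population solution, fixed before \<open>n\<close>, \<open>P\<close>
  and the sample. A union bound over the sign pairs and the gradient coordinates controls the
  probability of leaving the good event.\<close>

theorem theorem2:
  fixes f :: "real ^ 'p::finite \<Rightarrow> real"
    and J :: "'d::finite \<Rightarrow> 'p set"
    and \<xi> \<xi>bar :: "real ^ 'p"
    and M \<nu> \<epsilon> \<eta> :: real
  assumes "M > 0"
    and "\<And>x. x \<in> images \<Longrightarrow> \<bar>f x\<bar> \<le> M"
    and "\<xi> \<in> images"
    and "superpixels J"
    and "replacement_image J \<xi> \<xi>bar"
    and "\<nu> > 0"
    and "\<epsilon> > 0"
    and "0 < \<eta>" and "\<eta> < 1"
  shows "\<exists>\<beta>f :: real ^ ('d option). \<forall>n :: nat.
    int n \<ge> \<lceil>max (2 ^ 15 * real CARD('d) ^ 4 * exp (2 / \<nu>\<^sup>2))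
                (2 ^ 21 * real CARD('d) ^ 7 * max M (M\<^sup>2) * exp (4 / \<nu>\<^sup>2) / \<epsilon>\<^sup>2)
            * ln (8 * real CARD('d) / \<eta>)\<rceil> \<longrightarrow>
    (\<forall>(P :: 'w measure) z \<beta>hat.
       lime_sampling P n z \<longrightarrow>
       \<beta>hat \<in> borel_measurable P \<longrightarrow>
       (\<forall>\<omega>\<in>space P. lime_explanation f J \<xi> \<xi>bar \<nu> n (\<lambda>i. z i \<omega>) (\<beta>hat \<omega>)) \<longrightarrow>
       measure P {\<omega> \<in> space P. norm (\<beta>hat \<omega> - \<beta>f) \<ge> \<epsilon>} \<le> \<eta>)"
proof -
  define d w where "d = real CARD('d)" and "w = exp (- 1 / (2 * \<nu>\<^sup>2))"
  define p :: "('d \<Rightarrow> bool) \<Rightarrow> real" where "p = lime_weight \<nu>"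
  define y where "y a = f (perturbed_image J \<xi> \<xi>bar a)" for a
  define L where "L = ln (8 * d / \<eta>)"
  have d: "d \<ge> 1"
    by (simp add: d_def Suc_le_eq)
  have w: "0 < w" "w \<le> 1" "\<And>a. w \<le> p a" "\<And>a. p a \<le> 1"
    using lime_weight_bounds[OF \<open>\<nu> > 0\<close>] by (simp_all add: w_def p_def)
  \<comment> \<open>This turns the exponentials of the sample size into inverse powers of the least
    weight \<open>w\<close>.\<close>
  have w_powers: "exp (2 / \<nu>\<^sup>2) = 1 / w ^ 4" "exp (4 / \<nu>\<^sup>2) = 1 / w ^ 8"
  proof -
    have "w ^ 4 = exp (real 4 * (- 1 / (2 * \<nu>\<^sup>2)))" "w ^ 8 = exp (real 8 * (- 1 / (2 * \<nu>\<^sup>2)))"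
      by (simp_all only: w_def exp_of_nat_mult)
    then show "exp (2 / \<nu>\<^sup>2) = 1 / w ^ 4" "exp (4 / \<nu>\<^sup>2) = 1 / w ^ 8"
      by (simp_all add: exp_minus inverse_eq_divide)
  qed
  have y: "\<bar>y a\<bar> \<le> M" for a
    unfolding y_def
    by (intro assms(2) perturbed_image_in_images assms(3) replacement_image_in_images[OF assms(5)])
  have "8 * d / \<eta> > 1"
    using d assms by (simp add: field_simps)
  then have L: "L > 0" and exp_L: "exp (- L) = \<eta> / (8 * d)"
    using d assms by (auto simp: L_def exp_minus)
  obtain \<beta> :: "real ^ ('d option)" where
    \<beta>: "(\<Sum>a\<in>UNIV. (p a * (y a - design a \<bullet> \<beta>)) *\<^sub>R design a) = 0"
    and grad_bound: "\<And>a k. \<bar>p a * (y a - design a \<bullet> \<beta>) * design a $ k\<bar> \<le> 25 * d ^ 2 * M / w"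
    by (rule population_solution[of w p M y, OF w(1,3,4) \<open>M > 0\<close> y, folded d_def]) (rule that)
  define g where "g k a = p a * (y a - design a \<bullet> \<beta>) * design a $ k" for k a
  \<comment> \<open>Read coordinatewise, the population normal equations are the centring condition
    of the deviation bound.\<close>
  have g_mean: "(\<Sum>a\<in>UNIV. g k a) = 0" for k
    using arg_cong[OF \<beta>, of "\<lambda>x. x $ k"] by (simp add: g_def)
  define t where "t = \<epsilon> * w / (12 * d * sqrt (d + 1))"
  show ?thesis
  proof (intro exI[of _ \<beta>] allI impI)
    fix n and P :: "'w measure" and z \<beta>hat
    assume n_ge: "int n \<ge> \<lceil>max (2 ^ 15 * real CARD('d) ^ 4 * exp (2 / \<nu>\<^sup>2))
                (2 ^ 21 * real CARD('d) ^ 7 * max M (M\<^sup>2) * exp (4 / \<nu>\<^sup>2) / \<epsilon>\<^sup>2)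
            * ln (8 * real CARD('d) / \<eta>)\<rceil>"
      and samp: "lime_sampling P n z"
      and expl: "\<forall>\<omega>\<in>space P. lime_explanation f J \<xi> \<xi>bar \<nu> n (\<lambda>i. z i \<omega>) (\<beta>hat \<omega>)"
    interpret prob_space P
      using samp by (simp add: lime_sampling_def)
    have n_ge': "max (2 ^ 15 * d ^ 4 / w ^ 4) (2 ^ 21 * d ^ 7 * max M (M\<^sup>2) / w ^ 8 / \<epsilon>\<^sup>2) * L \<le> real n"
      using n_ge by (simp add: ceiling_le_iff w_powers d_def L_def)
    have expo: "2 * L \<le> real n * (1 / (4 * d))\<^sup>2 / (2 * 1\<^sup>2)"
      "L \<le> real n * t\<^sup>2 / (2 * (25 * d ^ 2 * M / w)\<^sup>2)"
      using sample_size_exponents[OF d w(1,2) \<open>M > 0\<close> \<open>\<epsilon> > 0\<close> less_imp_le[OF L] n_ge']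
      by (auto simp: t_def)
    \<comment> \<open>For \<open>n = 0\<close> the first exponent would be zero, contradicting
      \<open>L > 0\<close>.\<close>
    have n: "n > 0"
      using expo(1) L by (cases n) auto
    \<comment> \<open>The failure events \<open>O1\<close> and \<open>O2\<close> use non-strict
      inequalities, so their complements give the strict gradient bound needed for an error strictly
      below \<open>\<epsilon>\<close>.\<close>
    define O1 where "O1 = (\<lambda>(k, l). {\<omega> \<in> space P.
      \<bar>\<Sum>i=1..n. signs (z i \<omega>) k * signs (z i \<omega>) l\<bar> \<ge> real n * (1 / (4 * d))})"
    define O2 where "O2 k = {\<omega> \<in> space P. \<bar>\<Sum>i=1..n. g k (z i \<omega>)\<bar> \<ge> real n * t}" for k
    \<comment> \<open>Ordered pairs, with the intercept included: a pair containing
      \<open>None\<close> controls the empirical mean of a single sign.\<close>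
    define K :: "('d option \<times> 'd option) set" where "K = {(k, l). k \<noteq> l}"
    have O1: "O1 kl \<in> events" "prob (O1 kl) \<le> 2 * exp (- (2 * L))" if mem: "kl \<in> K" for kl
    proof -
      obtain k l where kl: "kl = (k, l)" "k \<noteq> l"
        using mem by (auto simp: K_def)
      have "\<bar>signs a k * signs a l\<bar> \<le> 1" for a
        by (simp add: signs_def split: option.split)
      note dev = lime_sampling_deviation[OF samp n zero_less_one this sum_signs_mult_eq_0[OF kl(2)],
          of "1 / (4 * d)"]
      show "O1 kl \<in> events"
        using dev(1) d by (simp add: O1_def kl(1))
      have "prob (O1 kl) \<le> 2 * exp (- (real n * (1 / (4 * d))\<^sup>2 / (2 * 1\<^sup>2)))"
        using dev(2) d by (simp add: O1_def kl(1))
      also have "\<dots> \<le> 2 * exp (- (2 * L))"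
        using expo(1) by simp
      finally show "prob (O1 kl) \<le> 2 * exp (- (2 * L))" .
    qed
    have O2: "O2 k \<in> events" "prob (O2 k) \<le> 2 * exp (- L)" for k
    proof -
      have t: "t \<ge> 0" and B: "25 * d ^ 2 * M / w > 0"
        using d w assms by (auto simp: t_def)
      note dev = lime_sampling_deviation[OF samp n B grad_bound[of _ k, folded g_def] g_mean t]
      show "O2 k \<in> events"
        using dev(1) by (simp add: O2_def)
      have "prob (O2 k) \<le> 2 * exp (- (real n * t\<^sup>2 / (2 * (25 * d ^ 2 * M / w)\<^sup>2)))"
        using dev(2) by (simp add: O2_def)
      also have "\<dots> \<le> 2 * exp (- L)"
        using expo(2) by simp
      finally show "prob (O2 k) \<le> 2 * exp (- L)" .
    qed
    have sub: "{\<omega> \<in> space P. norm (\<beta>hat \<omega> - \<beta>) \<ge> \<epsilon>} \<subseteq> (\<Union>kl\<in>K. O1 kl) \<union> (\<Union>k\<in>UNIV. O2 k)"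
    proof (rule subsetI, rule ccontr)
      fix \<omega>
      assume \<omega>: "\<omega> \<in> {\<omega> \<in> space P. norm (\<beta>hat \<omega> - \<beta>) \<ge> \<epsilon>}"
        and notin: "\<omega> \<notin> (\<Union>kl\<in>K. O1 kl) \<union> (\<Union>k\<in>UNIV. O2 k)"
      have "norm (\<beta>hat \<omega> - \<beta>) < \<epsilon>"
      proof (rule sample_solution_error[where z = "\<lambda>i. z i \<omega>" and p = p and y = y, OF w(1,3) n])
        show "is_arg_min (\<lambda>\<beta>. \<Sum>i=1..n. p (z i \<omega>) * (y (z i \<omega>) - design (z i \<omega>) \<bullet> \<beta>)\<^sup>2)
            (\<lambda>_. True) (\<beta>hat \<omega>)"
          using expl \<omega> by (simp add: lime_explanation_iff_least_squares p_def y_def)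
      next
        fix k l :: "'d option"
        assume "k \<noteq> l"
        then have "\<omega> \<notin> O1 (k, l)"
          using notin by (auto simp: K_def)
        then show "\<bar>\<Sum>i=1..n. signs (z i \<omega>) k * signs (z i \<omega>) l\<bar> \<le> real n * (1 / (4 * real CARD('d)))"
          using \<omega> by (simp add: O1_def d_def)
      next
        fix k
        have "\<omega> \<notin> O2 k"
          using notin by auto
        then show "\<bar>\<Sum>i=1..n. p (z i \<omega>) * (y (z i \<omega>) - design (z i \<omega>) \<bullet> \<beta>) * design (z i \<omega>) $ k\<bar>
            < real n * (\<epsilon> * w / (12 * real CARD('d) * sqrt (real CARD('d) + 1)))"
          using \<omega> by (simp add: O2_def g_def t_def d_def)
      qed
      then show False
        using \<omega> by simp
    qed
    have "real (card K) \<le> real CARD('d option \<times> 'd option)"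
      by (intro of_nat_mono card_mono) auto
    then have card_K: "real (card K) \<le> (d + 1)\<^sup>2"
      by (simp add: card_UNIV_option d_def power2_eq_square algebra_simps)
    have "(d + 1)\<^sup>2 \<le> (2 * d)\<^sup>2"
      using d by (intro power_mono) auto
    have "prob {\<omega> \<in> space P. norm (\<beta>hat \<omega> - \<beta>) \<ge> \<epsilon>} \<le> prob ((\<Union>kl\<in>K. O1 kl) \<union> (\<Union>k\<in>UNIV. O2 k))"
      using sub O1(1) O2(1) by (intro finite_measure_mono) auto
    also have "\<dots> \<le> prob (\<Union>kl\<in>K. O1 kl) + prob (\<Union>k\<in>UNIV. O2 k)"
      using O1(1) O2(1) by (intro measure_Un_le) auto
    also have "\<dots> \<le> (\<Sum>kl\<in>K. prob (O1 kl)) + (\<Sum>k\<in>UNIV. prob (O2 k))"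
      using O1(1) O2(1) by (intro add_mono finite_measure_subadditive_finite) auto
    also have "\<dots> \<le> (\<Sum>kl\<in>K. 2 * exp (- (2 * L))) + (\<Sum>k\<in>(UNIV :: 'd option set). 2 * exp (- L))"
      by (intro add_mono sum_mono O1(2) O2(2))
    also have "\<dots> = real (card K) * (2 * exp (- (2 * L))) + (d + 1) * (2 * exp (- L))"
      by (simp add: card_UNIV_option d_def add.commute)
    also have "\<dots> \<le> (2 * d)\<^sup>2 * (2 * exp (- (2 * L))) + (2 * d) * (2 * exp (- L))"
      using card_K \<open>(d + 1)\<^sup>2 \<le> (2 * d)\<^sup>2\<close> d by (intro add_mono mult_right_mono) auto
    \<comment> \<open>The squared tail cancels the quadratic count of pairs: the pairs contribute
      \<open>\<eta> * \<eta> / 8\<close> and the gradient coordinates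
      \<open>\<eta> / 2\<close>.\<close>
    also have "exp (- (2 * L)) = (\<eta> / (8 * d))\<^sup>2"
      unfolding exp_L[symmetric] by (simp add: exp_of_nat_mult[symmetric])
    also have "(2 * d)\<^sup>2 * (2 * (\<eta> / (8 * d))\<^sup>2) + (2 * d) * (2 * exp (- L)) = \<eta> * \<eta> / 8 + \<eta> / 2"
      using d by (simp add: exp_L power2_eq_square)
    also have "\<dots> \<le> \<eta>"
      using mult_left_le[of \<eta> \<eta>] assms(8,9) by linarith
    finally show "prob {\<omega> \<in> space P. norm (\<beta>hat \<omega> - \<beta>) \<ge> \<epsilon>} \<le> \<eta>" .
  qed
qed

end
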